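(* Let $s_1,\dots,s_N$ be a finite set of bets, where bet $s_k$ has winning probability $p_k\in[0,1]$ and cost $d_k>0$. If one selects the bets successively, each time taking a not yet used bet with maximum ratio $p_k/d_k$, then the expected money spent before winning is minimal. That is, if $\sigma$ is a permutation of $\{1,\dots,N\}$ with $$\frac{p_{\sigma(1)}}{d_{\sigma(1)}}\ge \frac{p_{\sigma(2)}}{d_{\sigma(2)}}\ge\dots\ge\frac{p_{\sigma(N)}}{d_{\sigma(N)}},$$ then $E(\sigma)\le E(\tau)$ for every permutation $\tau$ of $\{1,\dots,N\}$, where $E$ is the expected cost defined in the context. Likewise, if the costs $d_k$ are replaced by times $t_k>0$, then betting in the order of decreasing $p_k/t_k$ yields the minimum expected time to win.
   Context: All bets win the same prize, the success events of the bets are independent, each bet can be made only once, and the $p_k$ need not sum to $1$. A betting strategy is an ordering of all $N$ bets, i.e. a permutation $\tau$ of $\{1,\dots,N\}$: bets $s_{\tau(1)},s_{\tau(2)},\dots$ are made in this order until one wins. The expected money spent before winning with strategy $\tau$ is $$E(\tau)=\sum_{k=1}^{N}\Big(\sum_{l=1}^{k} d_{\tau(l)}\Big)\Big(\prod_{j=1}^{k-1}(1-p_{\tau(j)})\Big)p_{\tau(k)},$$ and the expected time before winning is the same expression with $t_i$ in place of $d_i$. Empty products equal $1$. *)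

theory Defs
  imports Complex_Main "HOL-Combinatorics.Permutations"
begin

text \<open>
  A strategy is a permutation \<open>\<tau>\<close> of \<open>{1..N}\<close>. The weight function \<open>w\<close> stands for the costs
  \<open>d\<close> or the times \<open>t\<close>. With independent success events, \<open>p (\<tau> k)\<close> times the product is the
  probability that the first win is at the \<open>k\<close>-th bet made. If no bet wins, the contribution
  is \<open>0\<close>: the expression is not conditioned on winning, as the \<open>p k\<close> need not ensure a win.
\<close>

definition expected_spent ::
  "nat \<Rightarrow> (nat \<Rightarrow> real) \<Rightarrow> (nat \<Rightarrow> real) \<Rightarrow> (nat \<Rightarrow> nat) \<Rightarrow> real" where
  "expected_spent N p w \<tau> =
     (\<Sum>k = 1..N. (\<Sum>l = 1..k. w (\<tau> l)) * (\<Prod>j = 1..k - 1. 1 - p (\<tau> j)) * p (\<tau> k))"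

definition decreasing_ratio ::
  "nat \<Rightarrow> (nat \<Rightarrow> real) \<Rightarrow> (nat \<Rightarrow> real) \<Rightarrow> (nat \<Rightarrow> nat) \<Rightarrow> bool" where
  "decreasing_ratio N p w \<sigma> \<longleftrightarrow>
     (\<forall>k\<in>{1..<N}. p (\<sigma> k) / w (\<sigma> k) \<ge> p (\<sigma> (k + 1)) / w (\<sigma> (k + 1)))"

end

theory Submission
  imports Defs
begin

text \<open>
  Write \<open>Q\<^sub>k\<close> for the probability that the first \<open>k\<close> bets all fail. The \<open>k\<close>-th bet is
  actually paid for with probability \<open>Q\<^sub>k\<^sub>-\<^sub>1\<close>, so the expected \<^emph>\<open>total\<close> outlay, whether
  or not a bet wins, is \<open>\<Sum>k. w (\<tau> k) * Q\<^sub>k\<^sub>-\<^sub>1\<close>. It exceeds the expected money spent before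
  winning by the outlay on the event that every bet fails, which is \<open>(\<Sum>k. w k) * Q\<^sub>N\<close>
  and does not depend on the order (\<open>expected_spent_eq_outlay\<close>). Hence it suffices to
  minimise the total outlay.

  The total outlay satisfies a recursion on lists of bets: pay for the head, and with the
  probability that it fails pay the outlay of the tail. An exchange argument applies: swapping two
  neighbours \<open>y, x\<close> to \<open>x, y\<close> leaves everything after them unchanged and changes the outlay
  by a nonnegative multiple of \<open>p y * w x - p x * w y\<close>, which is at most \<open>0\<close> when \<open>x\<close> has
  the larger ratio. So a bet of maximal ratio can be pulled to the front by successive swaps
  (\<open>outlay_pull_to_front\<close>), and induction on the list gives the optimality of every
  ordering by decreasing ratio (\<open>outlay_sorted_le\<close>). The argument for times is the same, the
  weight being arbitrary.
\<close>

fun outlay :: "('a \<Rightarrow> real) \<Rightarrow> ('a \<Rightarrow> real) \<Rightarrow> 'a list \<Rightarrow> real" where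
  "outlay p w [] = 0"
| "outlay p w (x # xs) = w x + (1 - p x) * outlay p w xs"

lemma outlay_append:
  "outlay p w (xs @ ys) = outlay p w xs + prod_list (map (\<lambda>x. 1 - p x) xs) * outlay p w ys"
  by (induction xs) (auto simp: algebra_simps)

text \<open>
  Each step moves \<open>x\<close> past one neighbour \<open>y\<close>. Cross-multiplied, the comparison of the ratios is
  exactly the sign condition for the swap; the rest of the list enters the two
  orders with the same factor \<open>(1 - p x) * (1 - p y)\<close>.
\<close>

lemma outlay_pull_to_front:
  assumes "w x > 0"
    and "\<And>y. y \<in> set ys \<Longrightarrow> w y > 0 \<and> p y \<le> 1 \<and> p y / w y \<le> p x / w x"
  shows "outlay p w (x # ys @ zs) \<le> outlay p w (ys @ x # zs)"
  using assms(2)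
proof (induction ys)
  case Nil
  show ?case by simp
next
  case (Cons y ys)
  have y: "w y > 0" "p y \<le> 1" "p y / w y \<le> p x / w x"
    using Cons.prems by auto
  have "p y * w x \<le> p x * w y"
    using y assms(1) by (simp add: field_simps)
  then have "outlay p w (x # y # ys @ zs) \<le> outlay p w (y # x # ys @ zs)"
    by (simp add: algebra_simps)
  also have "\<dots> \<le> outlay p w (y # ys @ x # zs)"
  proof -
    have "outlay p w (x # ys @ zs) \<le> outlay p w (ys @ x # zs)"
      using Cons by simp
    then have "(1 - p y) * outlay p w (x # ys @ zs) \<le> (1 - p y) * outlay p w (ys @ x # zs)"
      using y(2) by (intro mult_left_mono) auto
    then show ?thesis by simp
  qed
  finally show ?case by simp
qed

text \<open>
  The head of the sorted list has maximal ratio, so bringing it to the front of the competing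
  list does not increase the outlay; the tails are then compared by induction.
\<close>

lemma outlay_sorted_le:
  assumes "sorted_wrt (\<lambda>x y. p y / w y \<le> p x / w x) xs"
    and "mset ys = mset xs"
    and "\<And>x. x \<in> set xs \<Longrightarrow> w x > 0 \<and> p x \<le> 1"
  shows "outlay p w xs \<le> outlay p w ys"
  using assms
proof (induction xs arbitrary: ys)
  case Nil
  then show ?case by simp
next
  case (Cons x xs)
  have "x \<in> set ys"
    using mset_eq_setD[OF Cons.prems(2)] by simp
  then obtain us vs where ys: "ys = us @ x # vs"
    by (meson split_list)
  have mset: "mset (us @ vs) = mset xs"
    using Cons.prems(2) ys by simp
  have "outlay p w xs \<le> outlay p w (us @ vs)"
    using Cons.prems(1,3) by (intro Cons.IH mset) auto
  moreover have "1 - p x \<ge> 0"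
    using Cons.prems(3) by simp
  ultimately have "outlay p w (x # xs) \<le> outlay p w (x # us @ vs)"
    by (simp add: mult_left_mono)
  also have "\<dots> \<le> outlay p w (us @ x # vs)"
  proof (rule outlay_pull_to_front)
    show "w x > 0" using Cons.prems(3) by simp
    fix y assume "y \<in> set us"
    then have "y \<in> set xs" using mset_eq_setD[OF mset] by auto
    then show "w y > 0 \<and> p y \<le> 1 \<and> p y / w y \<le> p x / w x"
      using Cons.prems(1,3) by auto
  qed
  finally show ?case using ys by simp
qed

text \<open>
  The subtracted product is the outlay on the event that all \<open>n\<close> bets fail, which the
  expected money spent before winning does not count.
\<close>

lemma expected_spent_eq_outlay:
  "expected_spent n p w \<tau> =
     outlay p w (map \<tau> [1..<Suc n]) - (\<Sum>l = 1..n. w (\<tau> l)) * (\<Prod>j = 1..n. 1 - p (\<tau> j))"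
proof (induction n)
  case 0
  show ?case by (simp add: expected_spent_def)
next
  case (Suc n)
  have survival: "prod_list (map (\<lambda>x. 1 - p x) (map \<tau> [1..<Suc n])) = (\<Prod>j = 1..n. 1 - p (\<tau> j))"
    by (induction n) simp_all
  have "outlay p w (map \<tau> [1..<Suc (Suc n)]) =
      outlay p w (map \<tau> [1..<Suc n]) + (\<Prod>j = 1..n. 1 - p (\<tau> j)) * w (\<tau> (Suc n))"
    using survival outlay_append[of p w "map \<tau> [1..<Suc n]" "[\<tau> (Suc n)]"] by simp
  moreover have "expected_spent (Suc n) p w \<tau> = expected_spent n p w \<tau> +
      (\<Sum>l = 1..Suc n. w (\<tau> l)) * (\<Prod>j = 1..n. 1 - p (\<tau> j)) * p (\<tau> (Suc n))"
    by (simp add: expected_spent_def)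
  ultimately show ?case
    using Suc.IH by (simp add: algebra_simps)
qed

lemma decreasing_ratio_imp_sorted_wrt:
  assumes "decreasing_ratio N p w \<sigma>"
  shows "sorted_wrt (\<lambda>x y. p y / w y \<le> p x / w x) (map \<sigma> [1..<Suc N])"
proof -
  have "transp (\<lambda>x y. p y / w y \<le> p x / w x)"
    by (intro transpI) (rule order_trans)
  moreover have "p (\<sigma> (Suc (Suc i))) / w (\<sigma> (Suc (Suc i))) \<le> p (\<sigma> (Suc i)) / w (\<sigma> (Suc i))"
    if "Suc i < N" for i
    using assms that bspec[of "{1..<N}" _ "Suc i"] by (auto simp: decreasing_ratio_def)
  ultimately show ?thesis
    by (subst sorted_wrt_iff_nth_Suc_transp) (auto simp del: upt_Suc)
qed

lemma mset_map_permutes: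
  assumes "\<tau> permutes {1..N}"
  shows "mset (map \<tau> [1..<Suc N]) = mset [1..<Suc N]"
proof -
  have "\<tau> ` {1..<Suc N} = {1..<Suc N}"
    using permutes_image[OF assms] by (simp add: atLeastLessThanSuc_atLeastAtMost)
  then show ?thesis
    using permutes_inj_on[OF assms]
    by (subst set_eq_iff_mset_eq_distinct[symmetric])
       (auto simp del: upt_Suc simp: distinct_map)
qed

lemma expected_spent_decreasing_ratio_le:
  assumes p: "\<And>k. k \<in> {1..N} \<Longrightarrow> p k \<le> 1"
    and w: "\<And>k. k \<in> {1..N} \<Longrightarrow> w k > 0"
    and \<sigma>: "\<sigma> permutes {1..N}" "decreasing_ratio N p w \<sigma>"
    and \<tau>: "\<tau> permutes {1..N}"
  shows "expected_spent N p w \<sigma> \<le> expected_spent N p w \<tau>"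
proof -
  have "outlay p w (map \<sigma> [1..<Suc N]) \<le> outlay p w (map \<tau> [1..<Suc N])"
  proof (rule outlay_sorted_le)
    show "sorted_wrt (\<lambda>x y. p y / w y \<le> p x / w x) (map \<sigma> [1..<Suc N])"
      using \<sigma>(2) by (rule decreasing_ratio_imp_sorted_wrt)
    show "mset (map \<tau> [1..<Suc N]) = mset (map \<sigma> [1..<Suc N])"
      using mset_map_permutes[OF \<sigma>(1)] mset_map_permutes[OF \<tau>] by simp
    fix x assume "x \<in> set (map \<sigma> [1..<Suc N])"
    then have "x \<in> {1..N}"
      using permutes_image[OF \<sigma>(1)]
      by (simp add: atLeastLessThanSuc_atLeastAtMost del: upt_Suc)
    then show "w x > 0 \<and> p x \<le> 1"
      using p w by blast
  qed
  moreover have "(\<Sum>l = 1..N. w (\<pi> l)) * (\<Prod>j = 1..N. 1 - p (\<pi> j)) =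
      (\<Sum>l = 1..N. w l) * (\<Prod>j = 1..N. 1 - p j)" if "\<pi> permutes {1..N}" for \<pi>
    using sum.permute[OF that, of w] prod.permute[OF that, of "\<lambda>j. 1 - p j"]
    by (simp add: o_def)
  ultimately show ?thesis
    using \<sigma>(1) \<tau> by (simp add: expected_spent_eq_outlay del: upt_Suc)
qed

theorem theorem2p1:
  fixes N :: nat and p d t :: "nat \<Rightarrow> real"
  assumes "\<And>k. k \<in> {1..N} \<Longrightarrow> 0 \<le> p k \<and> p k \<le> 1"
  shows "((\<forall>k\<in>{1..N}. d k > 0) \<longrightarrow>
           (\<forall>\<sigma>. \<sigma> permutes {1..N} \<and> decreasing_ratio N p d \<sigma> \<longrightarrow>
             (\<forall>\<tau>. \<tau> permutes {1..N} \<longrightarrow> expected_spent N p d \<sigma> \<le> expected_spent N p d \<tau>)))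
       \<and> ((\<forall>k\<in>{1..N}. t k > 0) \<longrightarrow>
           (\<forall>\<sigma>. \<sigma> permutes {1..N} \<and> decreasing_ratio N p t \<sigma> \<longrightarrow>
             (\<forall>\<tau>. \<tau> permutes {1..N} \<longrightarrow> expected_spent N p t \<sigma> \<le> expected_spent N p t \<tau>)))"
  using assms expected_spent_decreasing_ratio_le by blast

end
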